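(* The satisfiability problem for $\mathsf{MSL}$ is decidable: there is an algorithm which, given a formula $\varphi\in\mathcal{L}_{\mathsf{MSL}}$, decides whether there exist a Kripke model $M$ and a state $w$ of $M$ with $M,w\vDash\varphi$.
   Context: Let $\mathbf{P}$ be a countable set of propositional letters. $\mathcal{L}_{\mathsf{MSL}}$ is given by $\varphi::=p\mid\neg\varphi\mid\varphi\land\varphi\mid\Diamond\varphi\mid\langle p:=\varphi\rangle\varphi$ with $p\in\mathbf{P}$. A (Kripke) model is $M=(W,R,V)$ with $W\neq\emptyset$, $R\subseteq W\times W$, $V:\mathbf{P}\to 2^W$. Truth: $M,w\vDash p$ iff $w\in V(p)$; Boolean connectives as usual; $M,w\vDash\Diamond\varphi$ iff $M,v\vDash\varphi$ for some $v$ with $Rwv$; $M,w\vDash\langle p:=\psi\rangle\varphi$ iff $M|_{p:=\psi},w\vDash\varphi$, where $M|_{p:=\psi}=(W,R,V')$ with $V'(p)=\{v\in W: M,v\vDash\psi\}$ and $V'(q)=V(q)$ for $q\neq p$. *)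

theory Defs
  imports Main "HOL-Library.Nat_Bijection"
begin

section \<open>Syntax and semantics of \<open>MSL\<close>\<close>

datatype 'p fm =
    Letter 'p
  | Neg "'p fm"
  | Conj "'p fm" "'p fm"
  | Dia "'p fm"
  | Subst 'p "'p fm" "'p fm"
    \<comment> \<open>\<open>Subst p \<psi> \<phi>\<close> is \<open>\<langle>p := \<psi>\<rangle>\<phi>\<close>\<close>

record ('w, 'p) kripke =
  worlds :: "'w set"
  rel :: "('w \<times> 'w) set"
  val :: "'p \<Rightarrow> 'w set"

definition kripke_model :: "('w, 'p) kripke \<Rightarrow> bool" where
  "kripke_model M \<longleftrightarrow>
     worlds M \<noteq> {} \<and> rel M \<subseteq> worlds M \<times> worlds M \<and> (\<forall>p. val M p \<subseteq> worlds M)"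

fun holds :: "('w, 'p) kripke \<Rightarrow> 'w \<Rightarrow> 'p fm \<Rightarrow> bool" where
  "holds M w (Letter p) \<longleftrightarrow> w \<in> val M p"
| "holds M w (Neg \<phi>) \<longleftrightarrow> \<not> holds M w \<phi>"
| "holds M w (Conj \<phi> \<psi>) \<longleftrightarrow> holds M w \<phi> \<and> holds M w \<psi>"
| "holds M w (Dia \<phi>) \<longleftrightarrow> (\<exists>v. (w, v) \<in> rel M \<and> holds M v \<phi>)"
| "holds M w (Subst p \<psi> \<phi>) \<longleftrightarrow>
     holds (M\<lparr>val := (val M)(p := {v \<in> worlds M. holds M v \<psi>})\<rparr>) w \<phi>"

text \<open>HOL cannot quantify over all types of worlds inside a formula, so satisfiability is relative
  to a type \<open>'w\<close> from which the worlds of the model are drawn. Unrestricted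
  satisfiability is recovered by showing that a formula satisfiable over any type whatsoever is
  satisfiable over the chosen one.\<close>

definition satisfiable :: "'w itself \<Rightarrow> 'p fm \<Rightarrow> bool" where
  "satisfiable U \<phi> \<longleftrightarrow>
     (\<exists>(M :: ('w, 'p) kripke) w. kripke_model M \<and> w \<in> worlds M \<and> holds M w \<phi>)"

section \<open>Algorithms\<close>

text \<open>Kleene's partial recursive functions. Programs carry no arity; a program applied to an
  argument list of unsuitable length may have no value.\<close>

datatype recf =
    Zero
  | Succ
  | Proj nat
  | Comp recf "recf list"
  | PrimRec recf recf
  | Mu recf

inductive evaluates :: "recf \<Rightarrow> nat list \<Rightarrow> nat \<Rightarrow> bool" where
  Zero: "evaluates Zero xs 0"
| Succ: "evaluates Succ [x] (Suc x)"
| Proj: "i < length xs \<Longrightarrow> evaluates (Proj i) xs (xs ! i)"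
| Comp: "list_all2 (\<lambda>g y. evaluates g xs y) gs ys \<Longrightarrow> evaluates f ys z \<Longrightarrow>
    evaluates (Comp f gs) xs z"
| PrimRec_0: "evaluates g xs y \<Longrightarrow> evaluates (PrimRec g h) (0 # xs) y"
| PrimRec_Suc: "evaluates (PrimRec g h) (n # xs) y \<Longrightarrow> evaluates h (n # y # xs) z \<Longrightarrow>
    evaluates (PrimRec g h) (Suc n # xs) z"
| Mu: "evaluates f (n # xs) 0 \<Longrightarrow> (\<forall>m<n. \<exists>y. evaluates f (m # xs) (Suc y)) \<Longrightarrow>
    evaluates (Mu f) xs n"

inductive_cases evaluates_elims:
  "evaluates Zero xs y"
  "evaluates Succ xs y"
  "evaluates (Proj i) xs y"
  "evaluates (Comp f gs) xs y"
  "evaluates (PrimRec g h) (0 # xs) y"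
  "evaluates (PrimRec g h) (Suc n # xs) y"
  "evaluates (Mu f) xs y"

lemma evaluates_deterministic:
  "evaluates f xs y \<Longrightarrow> evaluates f xs z \<Longrightarrow> y = z"
proof (induction arbitrary: z rule: evaluates.induct)
  case (Zero xs)
  then show ?case by (auto elim: evaluates_elims(1))
next
  case (Succ x)
  then show ?case by (rule evaluates_elims(2)) simp
next
  case (Proj i xs)
  from Proj.prems show ?case by (rule evaluates_elims(3)) simp
next
  case (Comp xs gs ys f z')
  from Comp.prems obtain ys' where
    ys': "list_all2 (\<lambda>g y. evaluates g xs y) gs ys'" "evaluates f ys' z"
    by (rule evaluates_elims(4))
  have "ys = ys'"
    using Comp.IH(1) ys'(1) by (auto simp: list_all2_conv_all_nth intro!: nth_equalityI)
  with Comp.IH(2) ys'(2) show ?case by simp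
next
  case (PrimRec_0 g xs y h)
  from PrimRec_0.prems have "evaluates g xs z" by (rule evaluates_elims(5))
  then show ?case by (rule PrimRec_0.IH)
next
  case (PrimRec_Suc g h n xs y z')
  from PrimRec_Suc.prems obtain y' where
    "evaluates (PrimRec g h) (n # xs) y'" "evaluates h (n # y' # xs) z"
    by (rule evaluates_elims(6))
  with PrimRec_Suc.IH show ?case by blast
next
  case (Mu f n xs)
  from Mu.prems have z: "evaluates f (z # xs) 0" "\<forall>m<z. \<exists>y. evaluates f (m # xs) (Suc y)"
    by (auto elim: evaluates_elims(7))
  have "\<not> z < n" using Mu.IH(2) z(1) by fastforce
  moreover have "\<not> n < z" using Mu.IH(1) z(2) by fastforce
  ultimately show ?case by simp
qed

text \<open>\<open>c\<close> presents the instances of the problem \<open>Q\<close> as natural numbers; nothing is required of the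
  algorithm on numbers that present no instance.\<close>

definition decidable :: "('a \<Rightarrow> nat) \<Rightarrow> ('a \<Rightarrow> bool) \<Rightarrow> bool" where
  "decidable c Q \<longleftrightarrow> (\<exists>f. \<forall>a. evaluates f [c a] (if Q a then 1 else 0))"

text \<open>The Goedel number of a formula, given a numbering \<open>e\<close> of the propositional letters.\<close>

primrec fm_code :: "('p \<Rightarrow> nat) \<Rightarrow> 'p fm \<Rightarrow> nat" where
  "fm_code e (Letter p) = prod_encode (0, e p)"
| "fm_code e (Neg \<phi>) = prod_encode (1, fm_code e \<phi>)"
| "fm_code e (Conj \<phi> \<psi>) = prod_encode (2, prod_encode (fm_code e \<phi>, fm_code e \<psi>))"
| "fm_code e (Dia \<phi>) = prod_encode (3, fm_code e \<phi>)"
| "fm_code e (Subst p \<psi> \<phi>) =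
     prod_encode (4, prod_encode (e p, prod_encode (fm_code e \<psi>, fm_code e \<phi>)))"

lemma inj_fm_code:
  assumes "inj e"
  shows "inj (fm_code e)"
proof (rule injI)
  fix \<phi> \<psi> assume "fm_code e \<phi> = fm_code e \<psi>"
  then show "\<phi> = \<psi>"
  proof (induction \<phi> arbitrary: \<psi>)
    case (Letter p) then show ?case using assms by (cases \<psi>) (auto dest: injD)
  next
    case (Neg \<phi>) then show ?case by (cases \<psi>) auto
  next
    case (Conj \<phi>1 \<phi>2) then show ?case by (cases \<psi>) auto
  next
    case (Dia \<phi>) then show ?case by (cases \<psi>) auto
  next
    case (Subst p \<phi>1 \<phi>2) then show ?case using assms by (cases \<psi>) (auto dest: injD)
  qed
qed

end

theory Submission
  imports Defs
begin

text \<open>A formula of degree \<open>n\<close> sees only \<open>n\<close> levels of a model and only finitely many letters, and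
  for a fixed finite set of letters there are finitely many pointed models up to
  \<open>n\<close>-bisimilarity. Each of them is represented by a hereditarily finite set: the set of letters
  true at the point, together with the set of representatives of its successors. Representatives
  are coded as natural numbers, and the code of a successor is smaller than the code of the point;
  so a single finite model on an initial segment \<open>{..<N}\<close> of the natural numbers contains a
  representative of every pointed model, and \<open>N\<close> is computable from the formula
  (\<open>satisfiable_imp_hf_model\<close>). This works for the full language because degrees add up along
  \<open>\<langle>p := \<psi>\<rangle>\<phi>\<close>: reassigning \<open>p\<close> costs as many levels as the truth of \<open>\<psi>\<close> depends on
  (\<open>bisim_update\<close>, \<open>bisim_holds\<close>). As the model is countable, it has a copy in every infinite type
  (\<open>hf_model_imp_satisfiable\<close>), which makes satisfiability independent of the type of worlds.

  What remains is an algorithm that evaluates a formula in that finite model. The valuation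
  changes during evaluation, so the recursion is not one on the formula alone. Instead, the
  algorithm searches for a number that codes a finite table of statements ``under the valuation
  \<open>V\<close>, the formula \<open>c\<close> has the truth set \<open>T\<close>'', each of which follows from other statements in the
  table by one clause of the semantics. Whether a number codes such a table is expressible with
  bounded quantifiers only, hence computable. The statements in a table are true
  (\<open>valid_table_sound\<close>), and every formula has a table (\<open>valid_table_exists\<close>), so the search
  terminates, and the formula is satisfiable iff the truth set found is nonempty.\<close>

section \<open>Updates and renaming of letters\<close>

text \<open>The model that \<open>\<langle>p := \<psi>\<rangle>\<close> produces, with a predicate \<open>X\<close> in place of the truth of \<open>\<psi>\<close>, so that
  updates of two models can be compared from what is known about their predicates.\<close>

definition update :: "'p \<Rightarrow> ('w \<Rightarrow> bool) \<Rightarrow> ('w, 'p) kripke \<Rightarrow> ('w, 'p) kripke" where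
  "update p X M = M\<lparr>val := (val M)(p := {v \<in> worlds M. X v})\<rparr>"

lemma update_simps [simp]:
  "worlds (update p X M) = worlds M" "rel (update p X M) = rel M"
  "val (update p X M) q = (if q = p then {v \<in> worlds M. X v} else val M q)"
  by (simp_all add: update_def)

lemma holds_Subst: "holds M w (Subst p \<psi> \<phi>) \<longleftrightarrow> holds (update p (\<lambda>v. holds M v \<psi>) M) w \<phi>"
  by (simp add: update_def)

text \<open>Injectivity is used at updates: reassigning \<open>e p\<close> must affect no letter other than \<open>p\<close>.\<close>

lemma holds_map_fm:
  assumes "inj e" "worlds M = worlds M'" "rel M = rel M'" "\<And>p. val M p = val M' (e p)"
  shows "holds M' w (map_fm e \<phi>) \<longleftrightarrow> holds M w \<phi>"
  using assms(2-)
proof (induction \<phi> arbitrary: M M' w)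
  case (Subst p \<psi> \<phi>)
  have "holds M' v (map_fm e \<psi>) \<longleftrightarrow> holds M v \<psi>" for v
    using Subst.prems by (rule Subst.IH(1))
  then show ?case
    unfolding fm.map holds_Subst using Subst.prems
    by (intro Subst.IH(2)) (simp_all add: inj_eq[OF assms(1)])
qed simp_all

lemma satisfiable_map_fm:
  fixes e :: "'p \<Rightarrow> nat"
  assumes "inj e"
  shows "satisfiable TYPE('w) (map_fm e \<phi>) \<longleftrightarrow> satisfiable TYPE('w) \<phi>"
proof
  assume "satisfiable TYPE('w) (map_fm e \<phi>)"
  then obtain M :: "('w, nat) kripke" and w
    where M: "kripke_model M" "w \<in> worlds M" "holds M w (map_fm e \<phi>)"
    unfolding satisfiable_def by blast
  let ?M = "\<lparr>worlds = worlds M, rel = rel M, val = (\<lambda>p. val M (e p))\<rparr>"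
  have "holds ?M w \<phi>" using holds_map_fm[OF assms, of ?M M w \<phi>] M(3) by simp
  moreover have "kripke_model ?M" using M(1) by (simp add: kripke_model_def)
  ultimately show "satisfiable TYPE('w) \<phi>" using M(2) unfolding satisfiable_def by fastforce
next
  assume "satisfiable TYPE('w) \<phi>"
  then obtain M :: "('w, 'p) kripke" and w where M: "kripke_model M" "w \<in> worlds M" "holds M w \<phi>"
    unfolding satisfiable_def by blast
  let ?M = "\<lparr>worlds = worlds M, rel = rel M, val = (\<lambda>q. {w. \<exists>p. q = e p \<and> w \<in> val M p})\<rparr>"
  have "holds ?M w (map_fm e \<phi>)"
    by (subst holds_map_fm[OF assms, of M]) (use M(3) in \<open>simp_all add: inj_eq[OF assms]\<close>)
  moreover have "kripke_model ?M" using M(1) by (auto simp: kripke_model_def)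
  ultimately show "satisfiable TYPE('w) (map_fm e \<phi>)"
    using M(2) unfolding satisfiable_def by fastforce
qed

text \<open>A constant of its own, because simplification would unfold the identity function in
  \<open>fm_code id\<close>.\<close>

definition fm_number :: "nat fm \<Rightarrow> nat" where
  "fm_number = fm_code id"

lemma fm_number_simps [simp]:
  "fm_number (Letter p) = prod_encode (0, p)"
  "fm_number (Neg \<phi>) = prod_encode (1, fm_number \<phi>)"
  "fm_number (Conj \<phi> \<psi>) = prod_encode (2, prod_encode (fm_number \<phi>, fm_number \<psi>))"
  "fm_number (Dia \<phi>) = prod_encode (3, fm_number \<phi>)"
  "fm_number (Subst p \<psi> \<phi>) =
     prod_encode (4, prod_encode (p, prod_encode (fm_number \<psi>, fm_number \<phi>)))"
  by (simp_all add: fm_number_def)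

lemma fm_number_map_fm: "fm_number (map_fm e \<phi>) = fm_code e \<phi>"
  by (induction \<phi>) simp_all

section \<open>Bisimulation of bounded depth\<close>

text \<open>The number of levels of a model on which the truth of a formula depends. A letter counts one
  level, since bisimilarity of depth \<open>0\<close> says nothing even about the point itself. Degrees add up
  in an update: \<open>\<phi>\<close> may look at \<open>p\<close> on the last level that it reaches, and \<open>\<psi>\<close> is evaluated from
  there.\<close>

primrec degree :: "'p fm \<Rightarrow> nat" where
  "degree (Letter p) = 1"
| "degree (Neg \<phi>) = degree \<phi>"
| "degree (Conj \<phi> \<psi>) = max (degree \<phi>) (degree \<psi>)"
| "degree (Dia \<phi>) = Suc (degree \<phi>)"
| "degree (Subst p \<psi> \<phi>) = degree \<psi> + degree \<phi>"

primrec bisim :: "'p set \<Rightarrow> nat \<Rightarrow> ('v, 'p) kripke \<Rightarrow> 'v \<Rightarrow> ('w, 'p) kripke \<Rightarrow> 'w \<Rightarrow> bool" where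
  "bisim P 0 M w M' w' \<longleftrightarrow> True"
| "bisim P (Suc n) M w M' w' \<longleftrightarrow>
     (\<forall>p\<in>P. w \<in> val M p \<longleftrightarrow> w' \<in> val M' p) \<and>
     (\<forall>v. (w, v) \<in> rel M \<longrightarrow> (\<exists>v'. (w', v') \<in> rel M' \<and> bisim P n M v M' v')) \<and>
     (\<forall>v'. (w', v') \<in> rel M' \<longrightarrow> (\<exists>v. (w, v) \<in> rel M \<and> bisim P n M v M' v'))"

lemma bisim_mono: "bisim P n M w M' w' \<Longrightarrow> m \<le> n \<Longrightarrow> bisim P m M w M' w'"
proof (induction n arbitrary: m w w')
  case (Suc n)
  then show ?case by (cases m) (simp_all, meson)
qed simp

lemma kripke_model_update: "kripke_model M \<Longrightarrow> kripke_model (update p X M)"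
  by (auto simp: kripke_model_def)

text \<open>If the truth of \<open>X\<close> depends on \<open>d\<close> levels only, then reassigning a letter by it costs at most \<open>d\<close>
  levels of bisimilarity: a world with \<open>d + n\<close> levels in common with another one agrees with it on
  \<open>X\<close>, and so do the worlds reached from it in fewer than \<open>n\<close> further steps.\<close>

lemma bisim_update:
  assumes "kripke_model M" "kripke_model M'"
    and X: "\<And>w w'. w \<in> worlds M \<Longrightarrow> w' \<in> worlds M' \<Longrightarrow> bisim P d M w M' w' \<Longrightarrow> X w \<longleftrightarrow> X' w'"
    and "bisim P (d + n) M w M' w'" "w \<in> worlds M" "w' \<in> worlds M'"
  shows "bisim P n (update p X M) w (update p X' M') w'"
  using assms(4-6)
proof (induction n arbitrary: w w')
  case (Suc n)
  have "bisim P d M w M' w'" using Suc.prems(1) by (rule bisim_mono) simp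
  with X Suc.prems have "X w \<longleftrightarrow> X' w'" by blast
  moreover have "\<And>v. (w, v) \<in> rel M \<Longrightarrow> v \<in> worlds M" "\<And>v. (w', v) \<in> rel M' \<Longrightarrow> v \<in> worlds M'"
    using assms(1,2) by (auto simp: kripke_model_def)
  ultimately show ?case using Suc.prems Suc.IH by auto meson+
qed simp

lemma bisim_holds:
  assumes "kripke_model M" "kripke_model M'" "w \<in> worlds M" "w' \<in> worlds M'"
    and "bisim P n M w M' w'" "degree \<phi> \<le> n" "set_fm \<phi> \<subseteq> P"
  shows "holds M w \<phi> \<longleftrightarrow> holds M' w' \<phi>"
  using assms
proof (induction \<phi> arbitrary: M M' w w' n)
  case (Letter p)
  then show ?case by (cases n) auto
next
  case (Conj \<phi> \<psi>)
  then show ?case by simp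
next
  case (Dia \<phi>)
  then obtain m where m: "n = Suc m" "degree \<phi> \<le> m" by (cases n) auto
  have *: "holds M v \<phi> \<longleftrightarrow> holds M' v' \<phi>"
    if "(w, v) \<in> rel M" "(w', v') \<in> rel M'" "bisim P m M v M' v'" for v v'
  proof -
    have "v \<in> worlds M" "v' \<in> worlds M'"
      using that(1,2) Dia.prems(1,2) by (auto simp: kripke_model_def)
    then show ?thesis using that(3) Dia.IH[OF Dia.prems(1,2), of v v' m] Dia.prems m by simp
  qed
  have b: "\<forall>v. (w, v) \<in> rel M \<longrightarrow> (\<exists>v'. (w', v') \<in> rel M' \<and> bisim P m M v M' v')"
    "\<forall>v'. (w', v') \<in> rel M' \<longrightarrow> (\<exists>v. (w, v) \<in> rel M \<and> bisim P m M v M' v')"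
    using Dia.prems(5) m by simp_all
  show ?case unfolding holds.simps using * b by meson
next
  case (Subst p \<psi> \<phi>)
  have "bisim P (degree \<phi>) (update p (\<lambda>v. holds M v \<psi>) M) w (update p (\<lambda>v. holds M' v \<psi>) M') w'"
  proof (rule bisim_update[OF Subst.prems(1,2)])
    show "bisim P (degree \<psi> + degree \<phi>) M w M' w'"
      using Subst.prems(5) by (rule bisim_mono) (use Subst.prems(6) in simp)
  next
    fix u u' assume "u \<in> worlds M" "u' \<in> worlds M'" "bisim P (degree \<psi>) M u M' u'"
    then show "holds M u \<psi> \<longleftrightarrow> holds M' u' \<psi>"
      using Subst.IH(1)[OF Subst.prems(1,2)] Subst.prems(7) by simp
  qed (use Subst.prems in auto)
  then show ?case unfolding holds_Subst
    using Subst.prems by (intro Subst.IH(2)) (auto intro: kripke_model_update)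
qed simp

section \<open>Hereditarily finite models\<close>

text \<open>A number \<open>w\<close> is read as a pair of finite sets, both coded in binary: the letters true at \<open>w\<close>, and
  its successors. Successors are smaller than \<open>w\<close>, so that these models are generated submodels of
  one and the same model on the natural numbers.\<close>

definition hf_model :: "nat \<Rightarrow> (nat, nat) kripke" where
  "hf_model N = \<lparr>worlds = {..<N},
     rel = {(w, v). w < N \<and> v \<in> set_decode (snd (prod_decode w))},
     val = (\<lambda>p. {w. w < N \<and> p \<in> set_decode (fst (prod_decode w))})\<rparr>"

lemma hf_model_simps [simp]:
  "worlds (hf_model N) = {..<N}"
  "(w, v) \<in> rel (hf_model N) \<longleftrightarrow> w < N \<and> v \<in> set_decode (snd (prod_decode w))"
  "w \<in> val (hf_model N) p \<longleftrightarrow> w < N \<and> p \<in> set_decode (fst (prod_decode w))"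
  by (simp_all add: hf_model_def)

lemma set_decode_less: "x \<in> set_decode t \<Longrightarrow> x < t"
proof -
  assume x: "x \<in> set_decode t"
  then have "2 ^ x \<le> t" by (auto simp: set_decode_def intro: ccontr)
  then show ?thesis using less_exp[of x] by linarith
qed

lemma successor_less:
  assumes "v \<in> set_decode (snd (prod_decode w))"
  shows "v < w"
proof -
  have "snd (prod_decode w) \<le> w" by (metis le_prod_encode_2 prod.collapse prod_decode_inverse)
  with set_decode_less[OF assms] show ?thesis by simp
qed

lemma kripke_model_hf_model: "N > 0 \<Longrightarrow> kripke_model (hf_model N)"
  by (auto simp: kripke_model_def hf_model_def dest: successor_less)

text \<open>The hereditarily finite representative of a world, up to bisimilarity of depth \<open>n\<close> for the
  letters below \<open>k\<close>. Even if the world has infinitely many successors, they have finitely many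
  representatives, because those of a given depth lie below \<open>world_bound\<close>.\<close>

primrec world_code :: "nat \<Rightarrow> ('v, nat) kripke \<Rightarrow> nat \<Rightarrow> 'v \<Rightarrow> nat" where
  "world_code k M 0 w = 0"
| "world_code k M (Suc n) w =
     prod_encode (set_encode {i. i < k \<and> w \<in> val M i},
                  set_encode (world_code k M n ` {v. (w, v) \<in> rel M}))"

primrec world_bound :: "nat \<Rightarrow> nat \<Rightarrow> nat" where
  "world_bound k 0 = 1"
| "world_bound k (Suc n) = prod_encode (2 ^ k, 2 ^ world_bound k n)"

lemma prod_encode_strict_mono: "a < c \<Longrightarrow> b < d \<Longrightarrow> prod_encode (a, b) < prod_encode (c, d)"
proof -
  assume "a < c" "b < d"
  moreover have "mono triangle" by (rule mono_iff_le_Suc[THEN iffD2], rule allI) simp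
  ultimately show ?thesis
    by (auto simp: prod_encode_def dest!: monoD[of triangle "a + b" "c + d"])
qed

lemma set_encode_less: "A \<subseteq> {..<n} \<Longrightarrow> set_encode A < 2 ^ n"
proof -
  assume A: "A \<subseteq> {..<n}"
  have "set_encode A \<le> set_encode {..<n}" unfolding set_encode_def using A by (intro sum_mono2) auto
  also have "\<dots> < 2 ^ n" unfolding set_encode_def by (induction n) auto
  finally show ?thesis .
qed

lemma world_code_less: "world_code k M n w < world_bound k n"
  by (induction n arbitrary: w) (auto intro!: prod_encode_strict_mono set_encode_less)

lemma bisim_world_code:
  assumes "world_code k M n w < N"
  shows "bisim {..<k} n M w (hf_model N) (world_code k M n w)"
  using assms
proof (induction n arbitrary: w)
  case (Suc n)
  have fin: "finite (world_code k M n ` {v. (w, v) \<in> rel M})"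
    by (rule finite_subset[of _ "{..<world_bound k n}"]) (auto simp: world_code_less)
  have less: "world_code k M n v < N" if "(w, v) \<in> rel M" for v
    by (rule less_trans[OF successor_less Suc.prems])
      (use fin that in \<open>auto simp: set_encode_inverse\<close>)
  show ?case
    using fin less Suc.IH Suc.prems by (auto simp: set_encode_inverse)
qed simp

text \<open>Along an injection, this is an isomorphic copy with worlds from another type.\<close>

definition image_model :: "('v \<Rightarrow> 'w) \<Rightarrow> ('v, 'p) kripke \<Rightarrow> ('w, 'p) kripke" where
  "image_model f M = \<lparr>worlds = f ` worlds M, rel = map_prod f f ` rel M, val = (\<lambda>p. f ` val M p)\<rparr>"

lemma kripke_model_image_model: "kripke_model M \<Longrightarrow> kripke_model (image_model f M)"
  by (fastforce simp: kripke_model_def image_model_def)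

lemma bisim_image_model: "inj f \<Longrightarrow> bisim P n M w (image_model f M) (f w)"
proof (induction n arbitrary: w)
  case (Suc n)
  then show ?case by (fastforce simp: image_model_def inj_image_mem_iff dest: injD)
qed simp

lemma holds_image_model:
  assumes "inj f" "kripke_model M" "w \<in> worlds M"
  shows "holds (image_model f M) (f w) \<phi> \<longleftrightarrow> holds M w \<phi>"
  using bisim_holds[OF assms(2) kripke_model_image_model[OF assms(2)] assms(3) _
      bisim_image_model[OF assms(1)] order_refl subset_UNIV, of \<phi>] assms(3)
  by (auto simp: image_model_def)

lemma le_prod_encode_add: "a + b \<le> prod_encode (a, b)"
proof -
  have "n \<le> triangle n" for n by (induction n) auto
  then show ?thesis by (simp add: prod_encode_def trans_le_add1)
qed

lemma degree_le_fm_number: "degree \<phi> \<le> Suc (fm_number \<phi>)"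
proof (induction \<phi>)
  case (Subst p \<psi> \<phi>)
  then show ?case
    using le_prod_encode_add[of "fm_number \<psi>" "fm_number \<phi>"]
      le_prod_encode_2[of "prod_encode (fm_number \<psi>, fm_number \<phi>)" p]
      le_prod_encode_add[of 4 "prod_encode (p, prod_encode (fm_number \<psi>, fm_number \<phi>))"]
    by simp
next
  case (Conj \<phi> \<psi>)
  then show ?case
    using le_prod_encode_add[of "fm_number \<phi>" "fm_number \<psi>"]
      le_prod_encode_add[of 2 "prod_encode (fm_number \<phi>, fm_number \<psi>)"]
    by simp
next
  case (Dia \<phi>)
  then show ?case using le_prod_encode_add[of 3 "fm_number \<phi>"] by simp
next
  case (Neg \<phi>)
  then show ?case using le_prod_encode_add[of 1 "fm_number \<phi>"] by simp
qed simp

lemma letter_le_fm_number: "p \<in> set_fm \<phi> \<Longrightarrow> p \<le> fm_number \<phi>"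
  by (induction \<phi>) (auto intro: order_trans[OF _ le_prod_encode_1] order_trans[OF _ le_prod_encode_2])

text \<open>If \<open>c\<close> is the number of a formula, then \<open>Suc c\<close> exceeds all letters of the formula and is at
  least its degree; so it serves both as the bound on letters and as the depth.\<close>

definition model_bound :: "nat \<Rightarrow> nat" where
  "model_bound c = world_bound (Suc c) (Suc c)"

lemma model_bound_pos: "model_bound c > 0"
  unfolding model_bound_def by (rule less_le_trans[OF _ world_code_less[THEN Suc_leI]]) simp

lemma satisfiable_imp_hf_model:
  assumes "satisfiable TYPE('v) \<phi>"
  shows "\<exists>w < model_bound (fm_number \<phi>). holds (hf_model (model_bound (fm_number \<phi>))) w \<phi>"
proof -
  let ?c = "fm_number \<phi>"
  let ?k = "Suc ?c"
  obtain M :: "('v, nat) kripke" and w where M: "kripke_model M" "w \<in> worlds M" "holds M w \<phi>"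
    using assms unfolding satisfiable_def by blast
  let ?w = "world_code ?k M ?k w"
  have less: "?w < model_bound ?c" unfolding model_bound_def by (rule world_code_less)
  have "bisim {..<?k} ?k M w (hf_model (model_bound ?c)) ?w"
    by (rule bisim_world_code[OF less])
  then have "holds M w \<phi> \<longleftrightarrow> holds (hf_model (model_bound ?c)) ?w \<phi>"
    using M(1,2) less degree_le_fm_number[of \<phi>] letter_le_fm_number[of _ \<phi>]
    by (intro bisim_holds[where n = ?k and P = "{..<?k}"])
      (auto intro: kripke_model_hf_model model_bound_pos simp: less_Suc_eq_le
        simp del: world_code.simps bisim.simps)
  with M less show ?thesis by blast
qed

lemma hf_model_imp_satisfiable:
  assumes "infinite (UNIV :: 'w set)" "w < N" "holds (hf_model N) w \<phi>"
  shows "satisfiable TYPE('w) \<phi>"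
proof -
  obtain f :: "nat \<Rightarrow> 'w" where "inj f" using infinite_countable_subset[OF assms(1)] by blast
  moreover have "kripke_model (hf_model N)" using assms(2) by (intro kripke_model_hf_model) simp
  ultimately show ?thesis
    unfolding satisfiable_def using assms(2,3)
    by (intro exI[of _ "image_model f (hf_model N)"] exI[of _ "f w"])
      (auto simp: holds_image_model kripke_model_image_model, simp add: image_model_def)
qed

section \<open>Tables of truth sets\<close>

text \<open>The statement that the formula with number \<open>c\<close> has the truth set coded by \<open>T\<close> under the
  valuation coded by \<open>V\<close>, which is a set of codes of pairs of a letter and a world.\<close>

definition entry :: "nat \<Rightarrow> nat \<Rightarrow> nat \<Rightarrow> nat" where
  "entry c V T = prod_encode (c, prod_encode (V, T))"

text \<open>The relation and the valuation of \<open>hf_model\<close>, with the decoding of pairs expressed by bounded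
  quantifiers. In this form their computability can be read off.\<close>

definition successor :: "nat \<Rightarrow> nat \<Rightarrow> bool" where
  "successor w v \<longleftrightarrow> (\<exists>a<Suc w. \<exists>s<Suc w. w = prod_encode (a, s) \<and> v \<in> set_decode s)"

definition initial_letter :: "nat \<Rightarrow> nat \<Rightarrow> bool" where
  "initial_letter w q \<longleftrightarrow> (\<exists>a<Suc w. \<exists>s<Suc w. w = prod_encode (a, s) \<and> q \<in> set_decode a)"

lemma ex_prod_encode_iff:
  "(\<exists>a<Suc w. \<exists>s<Suc w. w = prod_encode (a, s) \<and> P a s) \<longleftrightarrow> P (fst (prod_decode w)) (snd (prod_decode w))"
proof -
  obtain a s where w: "w = prod_encode (a, s)" by (metis prod.collapse prod_decode_inverse)
  show ?thesis unfolding w by (auto simp: less_Suc_eq_le le_prod_encode_1 le_prod_encode_2)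
qed

text \<open>One disjunct for each clause of the semantics. All witnesses are components of the formula or of
  entries of \<open>t\<close>, hence below \<open>t\<close>. In the last disjunct \<open>V'\<close> codes the valuation with \<open>p\<close>
  reassigned; it is determined only on the letters below \<open>k\<close> and the worlds below \<open>N\<close>.\<close>

definition supported :: "nat \<Rightarrow> nat \<Rightarrow> nat \<Rightarrow> nat \<Rightarrow> nat \<Rightarrow> nat \<Rightarrow> bool" where
  "supported N k t c V T \<longleftrightarrow>
     (\<exists>p<t. c = prod_encode (0, p) \<and>
       (\<forall>w<N. w \<in> set_decode T \<longleftrightarrow> prod_encode (p, w) \<in> set_decode V)) \<or>
     (\<exists>a<t. \<exists>A<t. c = prod_encode (1, a) \<and> entry a V A \<in> set_decode t \<and>
       (\<forall>w<N. w \<in> set_decode T \<longleftrightarrow> \<not> w \<in> set_decode A)) \<or>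
     (\<exists>a<t. \<exists>b<t. \<exists>A<t. \<exists>B<t. c = prod_encode (2, prod_encode (a, b)) \<and>
       entry a V A \<in> set_decode t \<and> entry b V B \<in> set_decode t \<and>
       (\<forall>w<N. w \<in> set_decode T \<longleftrightarrow> w \<in> set_decode A \<and> w \<in> set_decode B)) \<or>
     (\<exists>a<t. \<exists>A<t. c = prod_encode (3, a) \<and> entry a V A \<in> set_decode t \<and>
       (\<forall>w<N. w \<in> set_decode T \<longleftrightarrow> (\<exists>v<N. successor w v \<and> v \<in> set_decode A))) \<or>
     (\<exists>p<t. \<exists>a<t. \<exists>b<t. \<exists>A<t. \<exists>V'<t. c = prod_encode (4, prod_encode (p, prod_encode (a, b))) \<and>
       entry a V A \<in> set_decode t \<and> entry b V' T \<in> set_decode t \<and>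
       (\<forall>q<k. \<forall>w<N. prod_encode (q, w) \<in> set_decode V' \<longleftrightarrow>
          q = p \<and> w \<in> set_decode A \<or> q \<noteq> p \<and> prod_encode (q, w) \<in> set_decode V))"

definition valid_table :: "nat \<Rightarrow> nat \<Rightarrow> nat \<Rightarrow> bool" where
  "valid_table N k t \<longleftrightarrow>
     (\<forall>c<t. \<forall>V<t. \<forall>T<t. entry c V T \<in> set_decode t \<longrightarrow> supported N k t c V T)"

definition encodes_val :: "nat \<Rightarrow> nat \<Rightarrow> nat \<Rightarrow> (nat, nat) kripke \<Rightarrow> bool" where
  "encodes_val k N V M \<longleftrightarrow>
     (\<forall>p. \<forall>w<N. p < k \<longrightarrow> (prod_encode (p, w) \<in> set_decode V \<longleftrightarrow> w \<in> val M p))"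

lemma entry_less:
  assumes "entry c V T \<in> set_decode t"
  shows "c < t" "V < t" "T < t"
  using set_decode_less[OF assms] le_prod_encode_1[of c "prod_encode (V, T)"]
    le_prod_encode_2[of "prod_encode (V, T)" c] le_prod_encode_1[of V T] le_prod_encode_2[of T V]
  unfolding entry_def by linarith+

lemma valid_tableD: "valid_table N k t \<Longrightarrow> entry c V T \<in> set_decode t \<Longrightarrow> supported N k t c V T"
  unfolding valid_table_def using entry_less by blast

lemma successor_iff: "successor w v \<longleftrightarrow> v \<in> set_decode (snd (prod_decode w))"
  unfolding successor_def by (rule ex_prod_encode_iff)

lemma initial_letter_iff: "initial_letter w q \<longleftrightarrow> q \<in> set_decode (fst (prod_decode w))"
  unfolding initial_letter_def by (rule ex_prod_encode_iff)

lemma valid_table_sound: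
  assumes "valid_table N k t"
    and "entry (fm_number \<phi>) V T \<in> set_decode t" "encodes_val k N V M"
    and "worlds M = {..<N}" "rel M = rel (hf_model N)" "set_fm \<phi> \<subseteq> {..<k}" "w < N"
  shows "w \<in> set_decode T \<longleftrightarrow> holds M w \<phi>"
  using assms(2-)
proof (induction \<phi> arbitrary: V T M w)
  case (Letter p)
  from valid_tableD[OF assms(1) Letter.prems(1)] show ?case
    using Letter.prems by (auto simp: supported_def encodes_val_def)
next
  case (Neg \<phi>)
  from valid_tableD[OF assms(1) Neg.prems(1)] obtain A where
    "entry (fm_number \<phi>) V A \<in> set_decode t" "\<forall>w<N. w \<in> set_decode T \<longleftrightarrow> w \<notin> set_decode A"
    by (auto simp: supported_def)
  then show ?case using Neg.IH[of V A M w] Neg.prems by auto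
next
  case (Conj \<phi> \<psi>)
  from valid_tableD[OF assms(1) Conj.prems(1)] obtain A B where
    "entry (fm_number \<phi>) V A \<in> set_decode t" "entry (fm_number \<psi>) V B \<in> set_decode t"
    "\<forall>w<N. w \<in> set_decode T \<longleftrightarrow> w \<in> set_decode A \<and> w \<in> set_decode B"
    by (auto simp: supported_def)
  then show ?case
    using Conj.IH(1)[of V A M w] Conj.IH(2)[of V B M w] Conj.prems by (auto simp: image_Un)
next
  case (Dia \<phi>)
  from valid_tableD[OF assms(1) Dia.prems(1)] obtain A where A:
    "entry (fm_number \<phi>) V A \<in> set_decode t"
    "\<forall>w<N. w \<in> set_decode T \<longleftrightarrow> (\<exists>v<N. successor w v \<and> v \<in> set_decode A)"
    by (auto simp: supported_def)
  have "v \<in> set_decode A \<longleftrightarrow> holds M v \<phi>" if "v < N" for v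
    using Dia.IH[OF A(1)] Dia.prems that by simp
  moreover have "(w, v) \<in> rel M \<longleftrightarrow> v < N \<and> successor w v" for v
    using Dia.prems(4,6) successor_less[of v w] by (auto simp: successor_iff)
  ultimately show ?case using A(2) Dia.prems(6) by auto
next
  case (Subst p \<psi> \<phi>)
  from valid_tableD[OF assms(1) Subst.prems(1)] obtain A V' where A:
    "entry (fm_number \<psi>) V A \<in> set_decode t" "entry (fm_number \<phi>) V' T \<in> set_decode t"
    "\<forall>q<k. \<forall>w<N. prod_encode (q, w) \<in> set_decode V' \<longleftrightarrow>
          q = p \<and> w \<in> set_decode A \<or> q \<noteq> p \<and> prod_encode (q, w) \<in> set_decode V"
    by (auto simp: supported_def)
  have "v \<in> set_decode A \<longleftrightarrow> holds M v \<psi>" if "v < N" for v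
    using Subst.IH(1)[OF A(1) Subst.prems(2-4)] Subst.prems(5) that by (simp add: image_Un)
  then have "encodes_val k N V' (update p (\<lambda>v. holds M v \<psi>) M)"
    using A(3) Subst.prems(2,3) by (auto simp: encodes_val_def)
  then show ?case
    unfolding holds_Subst using Subst.prems(3-6) by (intro Subst.IH(2)[OF A(2)]) (simp_all add: image_Un)
qed

lemma set_decode_subset_imp_le: "set_decode s \<subseteq> set_decode t \<Longrightarrow> s \<le> t"
proof -
  assume "set_decode s \<subseteq> set_decode t"
  then have "set_encode (set_decode s) \<le> set_encode (set_decode t)"
    unfolding set_encode_def by (intro sum_mono2) auto
  then show ?thesis by simp
qed

text \<open>Witnesses stay below the bound and entries persist when the table grows.\<close>

lemma supported_mono:
  assumes "set_decode s \<subseteq> set_decode t" "supported N k s c V T"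
  shows "supported N k t c V T"
proof -
  have mem: "x \<in> set_decode s \<longrightarrow> x \<in> set_decode t" for x using assms(1) by blast
  have ex: "(\<exists>i<s. P i) \<longrightarrow> (\<exists>i<t. Q i)" if "\<And>i. P i \<longrightarrow> Q i" for P Q
    using set_decode_subset_imp_le[OF assms(1)] that order_less_le_trans by blast
  have "supported N k s c V T \<longrightarrow> supported N k t c V T"
    unfolding supported_def by (intro disj_mono ex conj_mono imp_refl mem)
  with assms(2) show ?thesis by blast
qed

lemma valid_table_Un:
  assumes "valid_table N k s" "valid_table N k t"
  shows "valid_table N k (set_encode (set_decode s \<union> set_decode t))"
proof -
  let ?u = "set_encode (set_decode s \<union> set_decode t)"
  have u: "set_decode ?u = set_decode s \<union> set_decode t" by (simp add: set_encode_inverse)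
  show ?thesis unfolding valid_table_def u
    using supported_mono[of s ?u N k] supported_mono[of t ?u N k] valid_tableD[OF assms(1)]
      valid_tableD[OF assms(2)] u by blast
qed

lemma entry_eq_iff [simp]: "entry c V T = entry c' V' T' \<longleftrightarrow> c = c' \<and> V = V' \<and> T = T'"
  by (auto simp: entry_def)

lemma valid_table_insert:
  assumes "valid_table N k t"
    and "supported N k (set_encode (insert (entry c V T) (set_decode t))) c V T"
  shows "valid_table N k (set_encode (insert (entry c V T) (set_decode t)))"
proof -
  let ?u = "set_encode (insert (entry c V T) (set_decode t))"
  have u: "set_decode ?u = insert (entry c V T) (set_decode t)" by (simp add: set_encode_inverse)
  show ?thesis unfolding valid_table_def u
    using supported_mono[of t ?u N k, unfolded u, OF subset_insertI] valid_tableD[OF assms(1)]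
      assms(2) by auto
qed

definition val_code :: "nat \<Rightarrow> nat \<Rightarrow> (nat, nat) kripke \<Rightarrow> nat" where
  "val_code k N M = set_encode {prod_encode (p, w) |p w. p < k \<and> w < N \<and> w \<in> val M p}"

lemma mem_val_code:
  "prod_encode (q, w) \<in> set_decode (val_code k N M) \<longleftrightarrow>
    q < k \<and> w < N \<and> w \<in> val M q"
proof -
  have "finite {prod_encode (p, w) |p w. p < k \<and> w < N \<and> w \<in> val M p}"
    by (rule finite_subset[of _ "prod_encode ` ({..<k} \<times> {..<N})"]) auto
  then show ?thesis by (auto simp: val_code_def set_encode_inverse)
qed

text \<open>The table collects the truth sets of all subformulas under all valuations that arise in the
  evaluation. The induction ranges over all models on the frame, because the body of an update is
  evaluated under another valuation.\<close>

lemma valid_table_exists: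
  assumes "worlds M = {..<N}" "rel M = rel (hf_model N)" "set_fm \<phi> \<subseteq> {..<k}"
  shows "\<exists>t. valid_table N k t \<and>
    entry (fm_number \<phi>) (val_code k N M) (set_encode {w. w < N \<and> holds M w \<phi>}) \<in> set_decode t"
  using assms
proof (induction \<phi> arbitrary: M)
  have dec: "w \<in> set_decode (set_encode {w. w < N \<and> P w}) \<longleftrightarrow> w < N \<and> P w" for w P
    by (simp add: set_encode_inverse)
  have ins: "set_decode (set_encode (insert x (set_decode s))) = insert x (set_decode s)" for x s
    by (simp add: set_encode_inverse)
  \<comment> \<open>It suffices to support the new entry by any table that extends a valid one.\<close>
  have extend: "\<exists>t. valid_table N k t \<and> entry c V T \<in> set_decode t"
    if "valid_table N k s"
      "\<And>u. c < u \<Longrightarrow> set_decode s \<subseteq> set_decode u \<Longrightarrow> supported N k u c V T" for s c V T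
  proof (intro exI conjI)
    let ?u = "set_encode (insert (entry c V T) (set_decode s))"
    show *: "entry c V T \<in> set_decode ?u" unfolding ins by simp
    have "set_decode s \<subseteq> set_decode ?u" unfolding ins by blast
    then show "valid_table N k ?u"
      by (intro valid_table_insert that(1) that(2)[OF entry_less(1)[OF *]])
  qed
  {
    case (Letter p)
    show ?case
    proof (rule extend)
      show "valid_table N k 0" by (simp add: valid_table_def)
      fix u assume "fm_number (Letter p) < u"
      then have "p < u" using le_prod_encode_2[of p 0] by simp
      then show "supported N k u (fm_number (Letter p)) (val_code k N M)
          (set_encode {w. w < N \<and> holds M w (Letter p)})"
        unfolding supported_def using Letter
        by (intro disjI1 exI[of _ p]) (auto simp: dec mem_val_code)
    qed
  next
    case (Neg \<phi>)
    from Neg.IH[OF Neg.prems(1,2)] Neg.prems(3) obtain s where s: "valid_table N k s"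
      "entry (fm_number \<phi>) (val_code k N M) (set_encode {w. w < N \<and> holds M w \<phi>}) \<in> set_decode s"
      by auto
    show ?case
    proof (rule extend[OF s(1)])
      fix u assume "set_decode s \<subseteq> set_decode u"
      with s(2) have u: "entry (fm_number \<phi>) (val_code k N M)
        (set_encode {w. w < N \<and> holds M w \<phi>}) \<in> set_decode u" by blast
      note less = entry_less[OF u]
      show "supported N k u (fm_number (Neg \<phi>)) (val_code k N M)
          (set_encode {w. w < N \<and> holds M w (Neg \<phi>)})"
        unfolding supported_def
        by (rule disjI2, rule disjI1, rule exI[of _ "fm_number \<phi>"], rule conjI[OF less(1)],
            rule exI, rule conjI[OF less(3)]) (use u in \<open>auto simp: dec\<close>)
    qed
  next
    case (Conj \<phi> \<psi>)
    from Conj.IH(1)[OF Conj.prems(1,2)] Conj.IH(2)[OF Conj.prems(1,2)] Conj.prems(3)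
    obtain s1 s2 where s: "valid_table N k s1" "valid_table N k s2"
      "entry (fm_number \<phi>) (val_code k N M) (set_encode {w. w < N \<and> holds M w \<phi>}) \<in> set_decode s1"
      "entry (fm_number \<psi>) (val_code k N M) (set_encode {w. w < N \<and> holds M w \<psi>}) \<in> set_decode s2"
      by (auto simp: image_Un)
    show ?case
    proof (rule extend[OF valid_table_Un[OF s(1,2)]])
      fix u assume "set_decode (set_encode (set_decode s1 \<union> set_decode s2)) \<subseteq> set_decode u"
      with s(3,4) have u:
        "entry (fm_number \<phi>) (val_code k N M) (set_encode {w. w < N \<and> holds M w \<phi>}) \<in> set_decode u"
        "entry (fm_number \<psi>) (val_code k N M) (set_encode {w. w < N \<and> holds M w \<psi>}) \<in> set_decode u"
        by (auto simp: set_encode_inverse)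
      note less = entry_less[OF u(1)] entry_less[OF u(2)]
      show "supported N k u (fm_number (Conj \<phi> \<psi>)) (val_code k N M)
          (set_encode {w. w < N \<and> holds M w (Conj \<phi> \<psi>)})"
        unfolding supported_def
        by (rule disjI2, rule disjI2, rule disjI1,
            rule exI[of _ "fm_number \<phi>"], rule conjI[OF less(1)],
            rule exI[of _ "fm_number \<psi>"], rule conjI[OF less(4)],
            rule exI, rule conjI[OF less(3)], rule exI, rule conjI[OF less(6)])
          (use u in \<open>auto simp: dec\<close>)
    qed
  next
    case (Dia \<phi>)
    from Dia.IH[OF Dia.prems(1,2)] Dia.prems(3) obtain s where s: "valid_table N k s"
      "entry (fm_number \<phi>) (val_code k N M) (set_encode {w. w < N \<and> holds M w \<phi>}) \<in> set_decode s"
      by auto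
    show ?case
    proof (rule extend[OF s(1)])
      fix u assume "set_decode s \<subseteq> set_decode u"
      with s(2) have u: "entry (fm_number \<phi>) (val_code k N M)
        (set_encode {w. w < N \<and> holds M w \<phi>}) \<in> set_decode u" by blast
      note less = entry_less[OF u]
      have rel: "(w, v) \<in> rel M \<longleftrightarrow> v < N \<and> successor w v" if "w < N" for w v
        using Dia.prems(2) that successor_less[of v w] by (auto simp: successor_iff)
      show "supported N k u (fm_number (Dia \<phi>)) (val_code k N M)
          (set_encode {w. w < N \<and> holds M w (Dia \<phi>)})"
        unfolding supported_def
        by (rule disjI2, rule disjI2, rule disjI2, rule disjI1,
            rule exI[of _ "fm_number \<phi>"], rule conjI[OF less(1)],
            rule exI, rule conjI[OF less(3)]) (use u rel in \<open>auto simp: dec\<close>)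
    qed
  next
    case (Subst p \<psi> \<phi>)
    let ?M = "update p (\<lambda>v. holds M v \<psi>) M"
    from Subst.IH(1)[of M] Subst.IH(2)[of ?M] Subst.prems
    obtain s1 s2 where s: "valid_table N k s1" "valid_table N k s2"
      "entry (fm_number \<psi>) (val_code k N M) (set_encode {w. w < N \<and> holds M w \<psi>}) \<in> set_decode s1"
      "entry (fm_number \<phi>) (val_code k N ?M) (set_encode {w. w < N \<and> holds ?M w \<phi>}) \<in> set_decode s2"
      by (auto simp: image_Un)
    show ?case
    proof (rule extend[OF valid_table_Un[OF s(1,2)]])
      fix u assume c: "fm_number (Subst p \<psi> \<phi>) < u"
        and "set_decode (set_encode (set_decode s1 \<union> set_decode s2)) \<subseteq> set_decode u"
      with s(3,4) have u:
        "entry (fm_number \<psi>) (val_code k N M) (set_encode {w. w < N \<and> holds M w \<psi>}) \<in> set_decode u"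
        "entry (fm_number \<phi>) (val_code k N ?M) (set_encode {w. w < N \<and> holds ?M w \<phi>}) \<in> set_decode u"
        by (auto simp: set_encode_inverse)
      have p: "p < u" using c
        le_prod_encode_1[of p "prod_encode (fm_number \<psi>, fm_number \<phi>)"]
        le_prod_encode_2[of "prod_encode (p, prod_encode (fm_number \<psi>, fm_number \<phi>))" 4]
        by simp
      note less = p entry_less[OF u(1)] entry_less[OF u(2)]
      show "supported N k u (fm_number (Subst p \<psi> \<phi>)) (val_code k N M)
          (set_encode {w. w < N \<and> holds M w (Subst p \<psi> \<phi>)})"
        unfolding supported_def
        by (rule disjI2, rule disjI2, rule disjI2, rule disjI2,
            rule exI[of _ p], rule conjI[OF less(1)],
            rule exI[of _ "fm_number \<psi>"], rule conjI[OF less(2)],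
            rule exI[of _ "fm_number \<phi>"], rule conjI[OF less(5)],
            rule exI, rule conjI[OF less(4)], rule exI, rule conjI[OF less(6)])
          (use u Subst.prems(1) in
            \<open>auto simp: dec holds_Subst mem_val_code simp del: holds.simps\<close>)
    qed
  }
qed

section \<open>Recursive functions of environments\<close>

text \<open>Arguments are presented by an environment \<open>\<rho>\<close>, the \<open>i\<close>-th argument being \<open>\<rho> i\<close>. Binding one more
  variable then amounts to the shift \<open>\<lambda>i. \<rho> (Suc i)\<close>, and the closure properties apply to terms with
  bounded quantifiers by higher-order unification alone.\<close>

definition computable :: "nat \<Rightarrow> ((nat \<Rightarrow> nat) \<Rightarrow> nat) \<Rightarrow> bool" where
  "computable n F \<longleftrightarrow> (\<exists>f. \<forall>\<rho>. evaluates f (map \<rho> [0..<n]) (F \<rho>))"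

definition computable_pred :: "nat \<Rightarrow> ((nat \<Rightarrow> nat) \<Rightarrow> bool) \<Rightarrow> bool" where
  "computable_pred n P \<longleftrightarrow> computable n (\<lambda>\<rho>. if P \<rho> then 1 else 0)"

lemma map_case_nat: "map (case_nat x \<rho>) [0..<Suc n] = x # map \<rho> [0..<n]"
  by (induction n) simp_all

lemma computable_var: "i < n \<Longrightarrow> computable n (\<lambda>\<rho>. \<rho> i)"
  unfolding computable_def using Proj[of i "map _ [0..<n]"] by (intro exI[of _ "Proj i"]) simp

lemma list_all2_Proj:
  "list_all2 (\<lambda>g y. evaluates g (map \<rho> [0..<n]) y) (map Proj [0..<n]) (map \<rho> [0..<n])"
  using Proj[of _ "map \<rho> [0..<n]"] by (simp add: list_all2_conv_all_nth)

lemma computable_compose: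
  assumes "computable m F" "\<And>i. i < m \<Longrightarrow> computable n (a i)"
  shows "computable n (\<lambda>\<rho>. F (\<lambda>i. a i \<rho>))"
proof -
  obtain f where f: "\<And>\<rho>. evaluates f (map \<rho> [0..<m]) (F \<rho>)"
    using assms(1) unfolding computable_def by blast
  have "\<forall>i\<in>{..<m}. \<exists>g. \<forall>\<rho>. evaluates g (map \<rho> [0..<n]) (a i \<rho>)"
    using assms(2) unfolding computable_def by blast
  from bchoice[OF this] obtain g
    where g: "\<And>i \<rho>. i < m \<Longrightarrow> evaluates (g i) (map \<rho> [0..<n]) (a i \<rho>)" by blast
  have "evaluates (Comp f (map g [0..<m])) (map \<rho> [0..<n]) (F (\<lambda>i. a i \<rho>))" for \<rho>
    by (rule Comp[where ys = "map (\<lambda>i. a i \<rho>) [0..<m]"])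
      (auto simp: list_all2_conv_all_nth g intro: f)
  then show ?thesis unfolding computable_def by blast
qed

lemma computable_compose1:
  assumes "computable 1 (\<lambda>\<rho>. g (\<rho> 0))" "computable n a"
  shows "computable n (\<lambda>\<rho>. g (a \<rho>))"
  using computable_compose[OF assms(1), of n "\<lambda>_. a"] assms(2) by simp

lemma computable_compose2:
  assumes "computable 2 (\<lambda>\<rho>. g (\<rho> 0) (\<rho> 1))" "computable n a" "computable n b"
  shows "computable n (\<lambda>\<rho>. g (a \<rho>) (b \<rho>))"
  using computable_compose[OF assms(1), of n "\<lambda>i. if i = 0 then a else b"] assms(2,3) by simp

lemma computable_Suc: "computable n a \<Longrightarrow> computable n (\<lambda>\<rho>. Suc (a \<rho>))"
proof (erule computable_compose1[rotated])
  show "computable 1 (\<lambda>\<rho>. Suc (\<rho> 0))"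
    unfolding computable_def using Succ by (intro exI[of _ Succ]) auto
qed

lemma computable_const: "computable n (\<lambda>_. c)"
proof (induction c)
  case 0
  show ?case unfolding computable_def using Zero by (intro exI[of _ Zero]) auto
qed (rule computable_Suc)

lemma computable_rec_nat:
  assumes "computable n b" "computable n g"
    and "computable (Suc (Suc n)) (\<lambda>\<rho>. h (\<rho> 0) (\<rho> 1) (\<lambda>i. \<rho> (Suc (Suc i))))"
  shows "computable n (\<lambda>\<rho>. rec_nat (g \<rho>) (\<lambda>i y. h i y \<rho>) (b \<rho>))"
proof -
  obtain fb where fb: "\<And>\<rho>. evaluates fb (map \<rho> [0..<n]) (b \<rho>)"
    using assms(1) unfolding computable_def by blast
  obtain fg where fg: "\<And>\<rho>. evaluates fg (map \<rho> [0..<n]) (g \<rho>)"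
    using assms(2) unfolding computable_def by blast
  obtain fh where fh: "\<And>\<rho>. evaluates fh (map \<rho> [0..<Suc (Suc n)]) (h (\<rho> 0) (\<rho> 1) (\<lambda>i. \<rho> (Suc (Suc i))))"
    using assms(3) unfolding computable_def by blast
  have step: "evaluates fh (x # y # map \<rho> [0..<n]) (h x y \<rho>)" for x y \<rho>
    using fh[of "case_nat x (case_nat y \<rho>)"] by (simp only: map_case_nat) simp
  have "evaluates (PrimRec fg fh) (x # map \<rho> [0..<n]) (rec_nat (g \<rho>) (\<lambda>i y. h i y \<rho>) x)" for x \<rho>
    by (induction x) (auto intro: PrimRec_0 PrimRec_Suc fg step)
  then have "evaluates (Comp (PrimRec fg fh) (fb # map Proj [0..<n])) (map \<rho> [0..<n])
      (rec_nat (g \<rho>) (\<lambda>i y. h i y \<rho>) (b \<rho>))" for \<rho>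
    by (intro Comp[where ys = "b \<rho> # map \<rho> [0..<n]"])
      (simp_all add: fb list_all2_Proj)
  then show ?thesis unfolding computable_def by blast
qed

lemma computable_add:
  assumes "computable n a" "computable n b"
  shows "computable n (\<lambda>\<rho>. a \<rho> + b \<rho>)"
proof (rule computable_compose2[OF _ assms])
  have "rec_nat x (\<lambda>i y. Suc y) z = x + z" for x z by (induction z) auto
  then show "computable 2 (\<lambda>\<rho>. \<rho> 0 + \<rho> 1)"
    using computable_rec_nat[of 2 "\<lambda>\<rho>. \<rho> 1" "\<lambda>\<rho>. \<rho> 0" "\<lambda>i y \<rho>. Suc y"]
    by (simp add: computable_var computable_Suc)
qed

lemma computable_mult:
  assumes "computable n a" "computable n b"
  shows "computable n (\<lambda>\<rho>. a \<rho> * b \<rho>)"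
proof (rule computable_compose2[OF _ assms])
  have "rec_nat 0 (\<lambda>i y. x + y) z = x * z" for x z :: nat by (induction z) auto
  then show "computable 2 (\<lambda>\<rho>. \<rho> 0 * \<rho> 1)"
    using computable_rec_nat[of 2 "\<lambda>\<rho>. \<rho> 1" "\<lambda>\<rho>. 0" "\<lambda>i y \<rho>. \<rho> 0 + y"]
    by (simp add: computable_var computable_add computable_const)
qed

lemma computable_power:
  assumes "computable n a" "computable n b"
  shows "computable n (\<lambda>\<rho>. a \<rho> ^ b \<rho>)"
proof (rule computable_compose2[OF _ assms])
  have "rec_nat 1 (\<lambda>i y. x * y) z = x ^ z" for x z :: nat by (induction z) auto
  then show "computable 2 (\<lambda>\<rho>. \<rho> 0 ^ \<rho> 1)"
    using computable_rec_nat[of 2 "\<lambda>\<rho>. \<rho> 1" "\<lambda>\<rho>. 1" "\<lambda>i y \<rho>. \<rho> 0 * y"]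
    by (simp add: computable_var computable_mult computable_const)
qed

lemma computable_diff:
  assumes "computable n a" "computable n b"
  shows "computable n (\<lambda>\<rho>. a \<rho> - b \<rho>)"
proof (rule computable_compose2[OF _ assms])
  have "rec_nat 0 (\<lambda>i y. i) z = z - 1" for z :: nat by (cases z) auto
  then have "computable 1 (\<lambda>\<rho>. \<rho> 0 - 1)"
    using computable_rec_nat[of 1 "\<lambda>\<rho>. \<rho> 0" "\<lambda>\<rho>. 0" "\<lambda>i y \<rho>. i"]
    by (simp add: computable_var computable_const)
  then have pred: "computable n a \<Longrightarrow> computable n (\<lambda>\<rho>. a \<rho> - 1)" for n a
    by (rule computable_compose1)
  have "rec_nat x (\<lambda>i y. y - 1) z = x - z" for x z :: nat by (induction z) auto
  then show "computable 2 (\<lambda>\<rho>. \<rho> 0 - \<rho> 1)"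
    using computable_rec_nat[of 2 "\<lambda>\<rho>. \<rho> 1" "\<lambda>\<rho>. \<rho> 0" "\<lambda>i y \<rho>. y - 1"]
    by (simp add: computable_var pred[unfolded One_nat_def])
qed

lemma computable_triangle:
  assumes "computable n a"
  shows "computable n (\<lambda>\<rho>. triangle (a \<rho>))"
proof (rule computable_compose1[OF _ assms])
  have "rec_nat 0 (\<lambda>i y. y + Suc i) z = triangle z" for z by (induction z) auto
  then show "computable 1 (\<lambda>\<rho>. triangle (\<rho> 0))"
    using computable_rec_nat[of 1 "\<lambda>\<rho>. \<rho> 0" "\<lambda>\<rho>. 0" "\<lambda>i y \<rho>. y + Suc i"]
    by (simp add: computable_var computable_const computable_add computable_Suc del: add_Suc_right)
qed

lemma computable_prod_encode:
  assumes "computable n a" "computable n b"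
  shows "computable n (\<lambda>\<rho>. prod_encode (a \<rho>, b \<rho>))"
  unfolding prod_encode_def prod.case by (intro computable_add computable_triangle assms)

lemma computable_pred_nonzero: "computable n a \<Longrightarrow> computable_pred n (\<lambda>\<rho>. a \<rho> \<noteq> 0)"
proof -
  assume "computable n a"
  then have "computable n (\<lambda>\<rho>. 1 - (1 - a \<rho>))" by (intro computable_diff computable_const)
  moreover have "1 - (1 - x) = (if x \<noteq> 0 then 1 else 0)" for x :: nat by simp
  ultimately show ?thesis unfolding computable_pred_def by simp
qed

lemma computable_pred_not: "computable_pred n P \<Longrightarrow> computable_pred n (\<lambda>\<rho>. \<not> P \<rho>)"
proof -
  assume "computable_pred n P"
  then have "computable n (\<lambda>\<rho>. 1 - (if P \<rho> then 1 else 0))"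
    unfolding computable_pred_def by (intro computable_diff computable_const)
  moreover have "1 - (if p then 1 else 0) = (if \<not> p then 1 else 0 :: nat)" for p by simp
  ultimately show ?thesis unfolding computable_pred_def by (simp only:)
qed

lemma computable_pred_conj:
  "computable_pred n P \<Longrightarrow> computable_pred n Q \<Longrightarrow> computable_pred n (\<lambda>\<rho>. P \<rho> \<and> Q \<rho>)"
proof -
  assume "computable_pred n P" "computable_pred n Q"
  then have "computable n (\<lambda>\<rho>. (if P \<rho> then 1 else 0) * (if Q \<rho> then 1 else 0))"
    unfolding computable_pred_def by (rule computable_mult)
  moreover have "(if p then 1 else 0) * (if q then 1 else 0) = (if p \<and> q then 1 else 0 :: nat)" for p q
    by simp
  ultimately show ?thesis unfolding computable_pred_def by (simp only:)
qed

lemma computable_pred_disj: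
  assumes "computable_pred n P" "computable_pred n Q"
  shows "computable_pred n (\<lambda>\<rho>. P \<rho> \<or> Q \<rho>)"
  using computable_pred_not[OF computable_pred_conj[OF assms[THEN computable_pred_not]]] by simp

lemma computable_pred_imp:
  assumes "computable_pred n P" "computable_pred n Q"
  shows "computable_pred n (\<lambda>\<rho>. P \<rho> \<longrightarrow> Q \<rho>)"
  using computable_pred_disj[OF computable_pred_not[OF assms(1)] assms(2)]
  by (simp only: imp_conv_disj)

lemma computable_pred_iff:
  assumes "computable_pred n P" "computable_pred n Q"
  shows "computable_pred n (\<lambda>\<rho>. P \<rho> \<longleftrightarrow> Q \<rho>)"
  unfolding iff_conv_conj_imp by (intro computable_pred_conj computable_pred_imp assms)

lemma computable_pred_eq:
  assumes "computable n a" "computable n b"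
  shows "computable_pred n (\<lambda>\<rho>. a \<rho> = b \<rho>)"
proof -
  \<comment> \<open>Subtraction is truncated; the numbers are equal iff both differences vanish.\<close>
  have "computable_pred n (\<lambda>\<rho>. \<not> (a \<rho> - b \<rho>) + (b \<rho> - a \<rho>) \<noteq> 0)"
    by (rule computable_pred_not, rule computable_pred_nonzero) (intro computable_add computable_diff assms)
  moreover have "(\<not> (x - y) + (y - x) \<noteq> 0) \<longleftrightarrow> x = y" for x y :: nat by auto
  ultimately show ?thesis by (simp only:)
qed

lemma computable_sum:
  assumes "computable n b" "computable (Suc n) (\<lambda>\<rho>. F (\<rho> 0) (\<lambda>i. \<rho> (Suc i)))"
  shows "computable n (\<lambda>\<rho>. \<Sum>i<b \<rho>. F i \<rho>)"
proof -
  \<comment> \<open>In the recursion step, position \<open>1\<close> of the environment holds the partial sum and is skipped.\<close>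
  have "computable (Suc (Suc n)) (\<lambda>\<rho>. F (\<rho> 0) (\<lambda>i. \<rho> (Suc (Suc i))))"
  proof -
    have "computable (Suc (Suc n)) (\<lambda>\<rho>. if i = 0 then \<rho> 0 else \<rho> (Suc i))" if "i < Suc n" for i
      using that by (cases i) (simp_all add: computable_var)
    then show ?thesis
      using computable_compose[OF assms(2), of "Suc (Suc n)"
          "\<lambda>i \<rho>. if i = 0 then \<rho> 0 else \<rho> (Suc i)"] by simp
  qed
  moreover have "rec_nat 0 (\<lambda>i y. y + F i \<rho>) z = (\<Sum>i<z. F i \<rho>)" for z \<rho>
    by (induction z) auto
  ultimately show ?thesis
    using computable_rec_nat[of n b "\<lambda>\<rho>. 0" "\<lambda>i y \<rho>. y + F i \<rho>"]
    by (simp add: assms(1) computable_var computable_const computable_add)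
qed

lemma computable_pred_ex_less:
  assumes "computable n b" "computable_pred (Suc n) (\<lambda>\<rho>. P (\<rho> 0) (\<lambda>i. \<rho> (Suc i)))"
  shows "computable_pred n (\<lambda>\<rho>. \<exists>i<b \<rho>. P i \<rho>)"
proof -
  have "computable_pred n (\<lambda>\<rho>. (\<Sum>i<b \<rho>. if P i \<rho> then 1 else 0 :: nat) \<noteq> 0)"
    using assms unfolding computable_pred_def[of "Suc n"]
    by (intro computable_pred_nonzero computable_sum)
  moreover have "(\<Sum>i<z. if P i \<rho> then 1 else 0 :: nat) \<noteq> 0 \<longleftrightarrow> (\<exists>i<z. P i \<rho>)" for z \<rho>
    by (auto split: if_splits)
  ultimately show ?thesis by (simp only:)
qed

lemma computable_pred_all_less:
  assumes "computable n b" "computable_pred (Suc n) (\<lambda>\<rho>. P (\<rho> 0) (\<lambda>i. \<rho> (Suc i)))"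
  shows "computable_pred n (\<lambda>\<rho>. \<forall>i<b \<rho>. P i \<rho>)"
  using computable_pred_not[OF computable_pred_ex_less[OF assms(1) computable_pred_not[OF assms(2)]]]
  by simp

text \<open>The binary digit of \<open>t\<close> at position \<open>x\<close> is \<open>1\<close>; \<open>q\<close> and \<open>r\<close> are the numbers formed by the digits
  above and below it.\<close>

lemma mem_set_decode_iff: "x \<in> set_decode t \<longleftrightarrow> (\<exists>q<Suc t. \<exists>r<2 ^ x. t = (2 * q + 1) * 2 ^ x + r)"
proof
  assume "x \<in> set_decode t"
  then have "odd (t div 2 ^ x)" by (simp add: set_decode_def)
  then obtain q where q: "t div 2 ^ x = 2 * q + 1" by (elim oddE)
  have "q \<le> t div 2 ^ x" using q by simp
  also have "\<dots> \<le> t" by simp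
  finally have "q < Suc t" by simp
  moreover have "t = (2 * q + 1) * 2 ^ x + t mod 2 ^ x" using div_mult_mod_eq[of t "2 ^ x"] unfolding q by simp
  ultimately show "\<exists>q<Suc t. \<exists>r<2 ^ x. t = (2 * q + 1) * 2 ^ x + r"
    by (intro exI[of _ q] exI[of _ "t mod 2 ^ x"] conjI) simp_all
next
  assume "\<exists>q<Suc t. \<exists>r<2 ^ x. t = (2 * q + 1) * 2 ^ x + r"
  then obtain q r where "r < 2 ^ x" "t = (2 * q + 1) * 2 ^ x + r" by blast
  then have "t div 2 ^ x = 2 * q + 1"
    using div_mult_self3[of "2 ^ x" "2 * q + 1" r] by simp
  then show "x \<in> set_decode t" by (simp add: set_decode_def)
qed

lemmas computable_basic_intros =
  computable_var computable_const computable_Suc computable_add computable_mult computable_power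
  computable_prod_encode computable_pred_not computable_pred_conj computable_pred_disj
  computable_pred_imp computable_pred_iff computable_pred_eq computable_pred_ex_less
  computable_pred_all_less

lemma computable_pred_mem_set_decode:
  assumes "computable n a" "computable n b"
  shows "computable_pred n (\<lambda>\<rho>. a \<rho> \<in> set_decode (b \<rho>))"
proof -
  have "computable_pred 2 (\<lambda>\<rho>. \<rho> 0 \<in> set_decode (\<rho> 1))"
    unfolding mem_set_decode_iff by (intro computable_basic_intros) simp_all
  then show ?thesis
    unfolding computable_pred_def by (rule computable_compose2[OF _ assms])
qed

lemmas computable_intros = computable_basic_intros computable_pred_mem_set_decode

text \<open>Unbounded search: the program may diverge on environments that admit no solution, so it is not
  captured by \<open>computable\<close>.\<close>

lemma evaluates_search:
  assumes "computable_pred (Suc n) (\<lambda>\<rho>. P (\<rho> 0) (\<lambda>i. \<rho> (Suc i)))"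
    "computable_pred (Suc n) (\<lambda>\<rho>. Q (\<rho> 0) (\<lambda>i. \<rho> (Suc i)))"
  shows "\<exists>f. \<forall>\<rho>. (\<exists>z. P z \<rho>) \<longrightarrow>
    evaluates f (map \<rho> [0..<n]) (if Q (LEAST z. P z \<rho>) \<rho> then 1 else 0)"
proof -
  \<comment> \<open>Minimisation looks for a zero, hence the negation.\<close>
  obtain p where "\<And>\<rho>. evaluates p (map \<rho> [0..<Suc n])
      (if \<not> P (\<rho> 0) (\<lambda>i. \<rho> (Suc i)) then 1 else 0)"
    using computable_pred_not[OF assms(1)] unfolding computable_pred_def computable_def by blast
  from this[of "case_nat _ _"] have p:
    "\<And>z \<rho>. evaluates p (z # map \<rho> [0..<n]) (if \<not> P z \<rho> then 1 else 0)"
    by (simp only: map_case_nat) simp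
  obtain q where "\<And>\<rho>. evaluates q (map \<rho> [0..<Suc n])
      (if Q (\<rho> 0) (\<lambda>i. \<rho> (Suc i)) then 1 else 0)"
    using assms(2) unfolding computable_pred_def computable_def by blast
  from this[of "case_nat _ _"] have q:
    "\<And>z \<rho>. evaluates q (z # map \<rho> [0..<n]) (if Q z \<rho> then 1 else 0)"
    by (simp only: map_case_nat) simp
  have "evaluates (Comp q (Mu p # map Proj [0..<n])) (map \<rho> [0..<n])
      (if Q (LEAST z. P z \<rho>) \<rho> then 1 else 0)" if "\<exists>z. P z \<rho>" for \<rho>
  proof -
    let ?z = "LEAST z. P z \<rho>"
    have "P ?z \<rho>" using that by (rule LeastI_ex)
    then have "evaluates p (?z # map \<rho> [0..<n]) 0" using p[of ?z \<rho>] by simp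
    moreover have "\<forall>m<?z. \<exists>y. evaluates p (m # map \<rho> [0..<n]) (Suc y)"
    proof (intro allI impI)
      fix m assume "m < ?z"
      then have "\<not> P m \<rho>" by (rule not_less_Least)
      then show "\<exists>y. evaluates p (m # map \<rho> [0..<n]) (Suc y)"
        using p[of m \<rho>] by (intro exI[of _ 0]) simp
    qed
    ultimately have "evaluates (Mu p) (map \<rho> [0..<n]) ?z" by (rule Mu)
    then show ?thesis
      by (intro Comp[where ys = "?z # map \<rho> [0..<n]"] q)
        (simp add: list_all2_Proj)
  qed
  then show ?thesis by blast
qed

section \<open>The decision procedure\<close>

text \<open>The valuation \<open>V\<close> is required to be that of the hereditarily finite model.\<close>

definition table_for :: "nat \<Rightarrow> nat \<Rightarrow> nat \<Rightarrow> nat \<Rightarrow> bool" where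
  "table_for c t V T \<longleftrightarrow> valid_table (model_bound c) (Suc c) t \<and> entry c V T \<in> set_decode t \<and>
     (\<forall>q<Suc c. \<forall>w<model_bound c. prod_encode (q, w) \<in> set_decode V \<longleftrightarrow> initial_letter w q)"

definition conclusive :: "nat \<Rightarrow> nat \<Rightarrow> bool" where
  "conclusive c t \<longleftrightarrow> (\<exists>V<t. \<exists>T<t. table_for c t V T)"

definition accepts :: "nat \<Rightarrow> nat \<Rightarrow> bool" where
  "accepts c t \<longleftrightarrow>
     (\<exists>V<t. \<exists>T<t. table_for c t V T \<and> (\<exists>w<model_bound c. w \<in> set_decode T))"

lemma table_for_sound:
  assumes "table_for (fm_number \<phi>) t V T" "w < model_bound (fm_number \<phi>)"
  shows "w \<in> set_decode T \<longleftrightarrow> holds (hf_model (model_bound (fm_number \<phi>))) w \<phi>"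
proof (rule valid_table_sound)
  show "encodes_val (Suc (fm_number \<phi>)) (model_bound (fm_number \<phi>)) V
      (hf_model (model_bound (fm_number \<phi>)))"
    using assms(1) by (auto simp: table_for_def encodes_val_def initial_letter_iff)
  show "set_fm \<phi> \<subseteq> {..<Suc (fm_number \<phi>)}"
    using letter_le_fm_number[of _ \<phi>] by (auto simp: less_Suc_eq_le)
qed (use assms in \<open>auto simp: table_for_def\<close>)

lemma conclusive_table_exists: "\<exists>t. conclusive (fm_number \<phi>) t"
proof -
  let ?c = "fm_number \<phi>"
  let ?M = "hf_model (model_bound ?c)"
  have "set_fm \<phi> \<subseteq> {..<Suc ?c}"
    using letter_le_fm_number[of _ \<phi>] by (auto simp: less_Suc_eq_le)
  then obtain t where t: "valid_table (model_bound ?c) (Suc ?c) t"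
    "entry ?c (val_code (Suc ?c) (model_bound ?c) ?M)
      (set_encode {w. w < model_bound ?c \<and> holds ?M w \<phi>}) \<in> set_decode t"
    using valid_table_exists[of ?M "model_bound ?c" \<phi> "Suc ?c"] by auto
  then have "table_for ?c t (val_code (Suc ?c) (model_bound ?c) ?M)
      (set_encode {w. w < model_bound ?c \<and> holds ?M w \<phi>})"
    by (simp add: table_for_def mem_val_code initial_letter_iff)
  then show ?thesis unfolding conclusive_def using entry_less[OF t(2)] by blast
qed

text \<open>By soundness, the verdict is the same for every table that the search may find.\<close>

lemma accepts_iff_satisfiable:
  assumes "infinite (UNIV :: 'w set)" "conclusive (fm_number \<phi>) t"
  shows "accepts (fm_number \<phi>) t \<longleftrightarrow> satisfiable TYPE('w) \<phi>"
proof
  assume "accepts (fm_number \<phi>) t"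
  then show "satisfiable TYPE('w) \<phi>"
    unfolding accepts_def using table_for_sound hf_model_imp_satisfiable[OF assms(1)] by blast
next
  assume "satisfiable TYPE('w) \<phi>"
  from satisfiable_imp_hf_model[OF this] assms(2) show "accepts (fm_number \<phi>) t"
    unfolding accepts_def conclusive_def using table_for_sound by blast
qed

lemma computable_model_bound:
  assumes "computable n a"
  shows "computable n (\<lambda>\<rho>. model_bound (a \<rho>))"
proof (rule computable_compose1[OF _ assms])
  have "rec_nat 1 (\<lambda>i y. prod_encode (2 ^ k, 2 ^ y)) n = world_bound k n" for k n
    by (induction n) simp_all
  then show "computable 1 (\<lambda>\<rho>. model_bound (\<rho> 0))"
    using computable_rec_nat[of 1 "\<lambda>\<rho>. Suc (\<rho> 0)" "\<lambda>\<rho>. 1"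
        "\<lambda>i y \<rho>. prod_encode (2 ^ Suc (\<rho> 0), 2 ^ y)"]
    unfolding model_bound_def
    by (simp add: computable_intros del: power_Suc)
qed

lemma computable_pred_table_for:
  assumes "computable n c" "computable n t" "computable n V" "computable n T"
  shows "computable_pred n (\<lambda>\<rho>. table_for (c \<rho>) (t \<rho>) (V \<rho>) (T \<rho>))"
proof -
  have "computable_pred 4 (\<lambda>\<rho>. table_for (\<rho> 0) (\<rho> 1) (\<rho> 2) (\<rho> 3))"
    unfolding table_for_def valid_table_def supported_def entry_def successor_def initial_letter_def
    by (intro computable_intros computable_model_bound) simp_all
  then have "computable_pred n (\<lambda>\<rho>. (\<lambda>\<rho>. table_for (\<rho> 0) (\<rho> 1) (\<rho> 2) (\<rho> 3))
      (\<lambda>i. [c \<rho>, t \<rho>, V \<rho>, T \<rho>] ! i))"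
    unfolding computable_pred_def
    by (rule computable_compose) (use assms in \<open>auto simp: less_Suc_eq numeral_eq_Suc\<close>)
  then show ?thesis by simp
qed

lemma decidable_satisfiable_nat:
  assumes "infinite (UNIV :: 'w set)"
  shows "decidable fm_number (satisfiable TYPE('w))"
proof -
  have "computable_pred (Suc 1) (\<lambda>\<rho>. conclusive (\<rho> (Suc 0)) (\<rho> 0))"
    "computable_pred (Suc 1) (\<lambda>\<rho>. accepts (\<rho> (Suc 0)) (\<rho> 0))"
    unfolding conclusive_def accepts_def
    by (intro computable_intros computable_model_bound computable_pred_table_for; simp)+
  from evaluates_search[of 1 "\<lambda>t \<rho>. conclusive (\<rho> 0) t" "\<lambda>t \<rho>. accepts (\<rho> 0) t", OF this]
  obtain f where f: "\<forall>\<rho>. (\<exists>t. conclusive (\<rho> 0) t) \<longrightarrow>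
      evaluates f (map \<rho> [0..<1]) (if accepts (\<rho> 0) (LEAST t. conclusive (\<rho> 0) t) then 1 else 0)"
    by blast
  have "evaluates f [fm_number \<phi>] (if satisfiable TYPE('w) \<phi> then 1 else 0)" for \<phi>
    using spec[OF f, of "\<lambda>_. fm_number \<phi>"] conclusive_table_exists[of \<phi>]
      accepts_iff_satisfiable[OF assms LeastI_ex[OF conclusive_table_exists[of \<phi>]]] by simp
  then show ?thesis unfolding decidable_def by blast
qed

theorem corollary2p9:
  fixes e :: "'p \<Rightarrow> nat"
  assumes "inj e" and "infinite (UNIV :: 'w set)"
  shows "decidable (fm_code e) (satisfiable TYPE('w)) \<and>
    (\<forall>\<phi> :: 'p fm. satisfiable TYPE('v) \<phi> \<longrightarrow> satisfiable TYPE('w) \<phi>)"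
proof (intro conjI allI impI)
  obtain f where
    "\<And>\<phi>. evaluates f [fm_number \<phi>] (if satisfiable TYPE('w) \<phi> then 1 else 0)"
    using decidable_satisfiable_nat[OF assms(2)] unfolding decidable_def by blast
  from this[of "map_fm e _"] show "decidable (fm_code e) (satisfiable TYPE('w))"
    unfolding decidable_def fm_number_map_fm satisfiable_map_fm[OF assms(1)] by blast
next
  fix \<phi> :: "'p fm"
  assume "satisfiable TYPE('v) \<phi>"
  then have "satisfiable TYPE('v) (map_fm e \<phi>)" by (simp add: satisfiable_map_fm[OF assms(1)])
  from satisfiable_imp_hf_model[OF this] have "satisfiable TYPE('w) (map_fm e \<phi>)"
    using hf_model_imp_satisfiable[OF assms(2)] by blast
  then show "satisfiable TYPE('w) \<phi>" by (simp add: satisfiable_map_fm[OF assms(1)])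
qed

end
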